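(* Consider the stochastic stationary optimization problem $$\min_{\bar X\in\mathcal L^2(\mathbb R^{n_x}),\,\bar U\in\mathcal L^2(\mathbb R^{n_u})}\ \|\bar X\|_Q^2+\|\bar U\|_R^2\quad\text{s.t. } \bar X \text{ and } A\bar X+B\bar U+EW' \text{ have the same distribution},$$ where $W'$ has the law of $W$ and is independent of $(\bar X,\bar U)$. Let $(\bar\mu_X^\star,\bar\mu_U^\star)$ be the probability measure of its solutions. Then $(\bar\mu_X^\star,\bar\mu_U^\star)$ is uniquely determined and equals $(\mu_X^\diamond,\mu_U^\diamond)$, and the minimum cost is $$\|W\|_{E^\top PE}^2+\|\mathbb E[W]\|_{\Delta\bar S}^2,\qquad \Delta\bar S=E^\top G+G^\top E-F^\top(R+B^\top PB)F.$$
   Context: $A\in\mathbb R^{n_x\times n_x}$, $B\in\mathbb R^{n_x\times n_u}$, $E\in\mathbb R^{n_x\times n_w}$; $Q\succeq0$, $R\succ0$; $(A,B)$ stabilizable, $(A,Q^{1/2})$ detectable. $W$ is a square-integrable random vector in $\mathbb R^{n_w}$ (the disturbance law). For symmetric $M$, $\|Z\|_M^2=\mathbb E[Z^\top MZ]$ (for deterministic $z$, $z^\top Mz$). Stationary quantities: $P$ stabilizing positive semidefinite solution of $P=Q+A^\top(P-PB(R+B^\top PB)^{-1}B^\top P)A$; $K=-(R+B^\top PB)^{-1}B^\top PA$; $\tilde A=A+BK$ (Schur stable); $G$ the unique solution of $G=\tilde A^\top(PE+G)$; $F=-(R+B^\top PB)^{-1}B^\top(PE+G)$; $\tilde F=BF+E$.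 $\mu_X^\diamond$ is the law of $X_\infty:=(I-\tilde A)^{-1}\tilde F\mathbb E[W]+\sum_{j=0}^\infty\tilde A^jE(W_j-\mathbb E[W])$ with $W_j$ i.i.d. copies of $W$, and $\mu_U^\diamond$ is the law of $KX_\infty+F\mathbb E[W]$; $(\mu_X^\diamond,\mu_U^\diamond)$ is the limit of the laws of the overtakingly optimal trajectory of the infinite-horizon stochastic LQ problem with dynamics $X_{k+1}=AX_k+BU_k+EW_k$. *)

theory Defs
  imports "HOL-Analysis.Analysis" "HOL-Probability.Probability"
begin

fun matpow :: "real^'n^'n \<Rightarrow> nat \<Rightarrow> real^'n^'n" where
  "matpow M 0 = mat 1"
| "matpow M (Suc k) = M ** matpow M k"

definition cmat :: "real^'n^'m \<Rightarrow> complex^'n^'m" where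
  "cmat M = (\<chi> i j. complex_of_real (M $ i $ j))"

definition schur_stable :: "real^'n^'n \<Rightarrow> bool" where
  "schur_stable M \<longleftrightarrow>
     (\<forall>(c::complex) (v::complex^'n). v \<noteq> 0 \<and> cmat M *v v = c *s v \<longrightarrow> cmod c < 1)"

definition stabilizable :: "real^'n^'n \<Rightarrow> real^'u^'n \<Rightarrow> bool" where
  "stabilizable A B \<longleftrightarrow> (\<exists>K::real^'n^'u. schur_stable (A + B ** K))"

text \<open>Detectability of (A, Q^(1/2)): (A, C) is detectable for a factor C with C^T C = Q
  (all such factors have the same kernel as Q^(1/2), so the choice does not matter).\<close>
definition detectable_sqrt :: "real^'n^'n \<Rightarrow> real^'n^'n \<Rightarrow> bool" where
  "detectable_sqrt A Q \<longleftrightarrow>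
     (\<exists>C::real^'n^'n. transpose C ** C = Q \<and> (\<exists>L::real^'n^'n. schur_stable (A + L ** C)))"

definition psd :: "real^'n^'n \<Rightarrow> bool" where
  "psd M \<longleftrightarrow> transpose M = M \<and> (\<forall>x. 0 \<le> x \<bullet> (M *v x))"

definition pd :: "real^'n^'n \<Rightarrow> bool" where
  "pd M \<longleftrightarrow> transpose M = M \<and> (\<forall>x. x \<noteq> 0 \<longrightarrow> 0 < x \<bullet> (M *v x))"

definition dare :: "real^'n^'n \<Rightarrow> real^'u^'n \<Rightarrow> real^'n^'n \<Rightarrow> real^'u^'u \<Rightarrow> real^'n^'n \<Rightarrow> bool" where
  "dare A B Q R P \<longleftrightarrow>
     P = Q + transpose A ** (P - P ** B ** matrix_inv (R + transpose B ** P ** B) ** transpose B ** P) ** A"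

definition gainK :: "real^'n^'n \<Rightarrow> real^'u^'n \<Rightarrow> real^'u^'u \<Rightarrow> real^'n^'n \<Rightarrow> real^'n^'u" where
  "gainK A B R P = - (matrix_inv (R + transpose B ** P ** B) ** transpose B ** P ** A)"

definition Acl :: "real^'n^'n \<Rightarrow> real^'u^'n \<Rightarrow> real^'u^'u \<Rightarrow> real^'n^'n \<Rightarrow> real^'n^'n" where
  "Acl A B R P = A + B ** gainK A B R P"

definition gainF :: "real^'u^'n \<Rightarrow> real^'u^'u \<Rightarrow> real^'n^'n \<Rightarrow> real^'w^'n \<Rightarrow> real^'w^'n \<Rightarrow> real^'w^'u" where
  "gainF B R P E G = - (matrix_inv (R + transpose B ** P ** B) ** transpose B ** (P ** E + G))"

definition Ftil :: "real^'u^'n \<Rightarrow> real^'u^'u \<Rightarrow> real^'n^'n \<Rightarrow> real^'w^'n \<Rightarrow> real^'w^'n \<Rightarrow> real^'w^'n" where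
  "Ftil B R P E G = B ** gainF B R P E G + E"

definition DeltaS :: "real^'u^'n \<Rightarrow> real^'u^'u \<Rightarrow> real^'n^'n \<Rightarrow> real^'w^'n \<Rightarrow> real^'w^'n \<Rightarrow> real^'w^'w" where
  "DeltaS B R P E G = transpose E ** G + transpose G ** E
     - transpose (gainF B R P E G) ** (R + transpose B ** P ** B) ** gainF B R P E G"

definition mean :: "('a::euclidean_space) measure \<Rightarrow> 'a" where
  "mean \<mu> = integral\<^sup>L \<mu> (\<lambda>w. w)"

definition wnorm2 :: "(real^'n) measure \<Rightarrow> real^'n^'n \<Rightarrow> real" where
  "wnorm2 \<mu> M = integral\<^sup>L \<mu> (\<lambda>w. w \<bullet> (M *v w))"

text \<open>The stationary state X_inf built from i.i.d. copies (\<omega> j) of W, j = 0,1,2,...;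
  the i.i.d. sequence lives on the infinite product probability space.\<close>
definition Xinf :: "real^'n^'n \<Rightarrow> real^'u^'n \<Rightarrow> real^'u^'u \<Rightarrow> real^'n^'n \<Rightarrow> real^'w^'n \<Rightarrow> real^'w^'n
     \<Rightarrow> (real^'w) measure \<Rightarrow> (nat \<Rightarrow> real^'w) \<Rightarrow> real^'n" where
  "Xinf A B R P E G \<mu>W \<omega> =
     matrix_inv (mat 1 - Acl A B R P) *v (Ftil B R P E G *v mean \<mu>W)
     + (\<Sum>j. matpow (Acl A B R P) j *v (E *v (\<omega> j - mean \<mu>W)))"

definition iid_space :: "(real^'w) measure \<Rightarrow> (nat \<Rightarrow> real^'w) measure" where
  "iid_space \<mu>W = PiM UNIV (\<lambda>_. \<mu>W)"

definition muX_diamond where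
  "muX_diamond A B R P E G \<mu>W = distr (iid_space \<mu>W) borel (Xinf A B R P E G \<mu>W)"

definition muU_diamond where
  "muU_diamond A B R P E G \<mu>W = distr (iid_space \<mu>W) borel
      (\<lambda>\<omega>. gainK A B R P *v Xinf A B R P E G \<mu>W \<omega> + gainF B R P E G *v mean \<mu>W)"

text \<open>Decision variable of the stationary problem: the joint law \<nu> of (Xbar, Ubar).
  Since W' is independent of (Xbar, Ubar) with law \<mu>W, the joint law of (Xbar, Ubar, W')
  is \<nu> \<otimes> \<mu>W.\<close>
definition feasible :: "real^'n^'n \<Rightarrow> real^'u^'n \<Rightarrow> real^'w^'n \<Rightarrow> (real^'w) measure
     \<Rightarrow> ((real^'n) \<times> (real^'u)) measure \<Rightarrow> bool" where
  "feasible A B E \<mu>W \<nu> \<longleftrightarrow>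
     prob_space \<nu> \<and> sets \<nu> = sets borel
     \<and> integrable \<nu> (\<lambda>z. (norm (fst z))\<^sup>2) \<and> integrable \<nu> (\<lambda>z. (norm (snd z))\<^sup>2)
     \<and> distr (\<nu> \<Otimes>\<^sub>M \<mu>W) borel (\<lambda>(z, w). A *v fst z + B *v snd z + E *v w) = distr \<nu> borel fst"

definition cost :: "real^'n^'n \<Rightarrow> real^'u^'u \<Rightarrow> ((real^'n) \<times> (real^'u)) measure \<Rightarrow> real" where
  "cost Q R \<nu> = integral\<^sup>L \<nu> (\<lambda>z. fst z \<bullet> (Q *v fst z) + snd z \<bullet> (R *v snd z))"

end

theory Submission
  imports Defs "HOL-Computational_Algebra.Fundamental_Theorem_Algebra"
begin

text \<open>With \<open>m = E[W]\<close>, \<open>M = R + B\<^sup>T P B\<close> and \<open>V x = x\<^sup>T P x + 2 x\<^sup>T G m\<close>, the equations for \<open>P\<close> and \<open>G\<close>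
  complete the square: the stage cost at \<open>(x, u)\<close> plus \<open>E[V(A x + B u + E W)] - V x\<close> equals the claimed
  minimum plus \<open>d\<^sup>T M d\<close> with \<open>d = u - K x - F m\<close>. Under a feasible law the \<open>V\<close>-terms cancel by
  stationarity, so a feasible law is optimal iff \<open>u = K x + F m\<close> almost surely. Then the state law is
  stationary for \<open>x \<mapsto> (A + B K) x + B F m + E W\<close>. The law of \<open>X\<^sub>\<infinity>\<close> is stationary because prepending
  an independent copy of \<open>W\<close> preserves the i.i.d. law of the noise sequence, and it is the only such law
  with finite mean because the iterated transition operator flattens Lipschitz functions.\<close>

subsection \<open>Powers of Schur stable matrices\<close>

text \<open>Horner's scheme for the vector p(M) v. Folding over the coefficients stays at the level
  of vectors and makes induction on \<open>pCons\<close> the natural proof method.\<close>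

definition poly_apply :: "complex^'n^'n \<Rightarrow> complex poly \<Rightarrow> complex^'n \<Rightarrow> complex^'n" where
  "poly_apply M p v = fold_coeffs (\<lambda>a w. a *s v + M *v w) p 0"

lemma poly_apply_0 [simp]: "poly_apply M 0 v = 0"
  by (simp add: poly_apply_def)

lemma poly_apply_pCons [simp]: "poly_apply M (pCons a p) v = a *s v + M *v poly_apply M p v"
  by (cases "p = 0 \<and> a = 0") (auto simp: poly_apply_def)

lemma poly_apply_add: "poly_apply M (p + q) v = poly_apply M p v + poly_apply M q v"
  by (induction p q rule: poly_induct2)
     (simp_all add: matrix_vector_right_distrib vec.scale_left_distrib algebra_simps)

lemma poly_apply_smult: "poly_apply M (smult c p) v = c *s poly_apply M p v"
  by (induction p)
     (simp_all add: vec.scale_right_distrib vector_smult_assoc vector_scalar_commute)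

lemma poly_apply_diff: "poly_apply M (p - q) v = poly_apply M p v - poly_apply M q v"
  using poly_apply_add[of M "p - q" q v] by (simp add: algebra_simps)

lemma poly_apply_sum: "poly_apply M (sum f S) v = (\<Sum>i\<in>S. poly_apply M (f i) v)"
  by (induction S rule: infinite_finite_induct) (simp_all add: poly_apply_add)

lemma poly_apply_monom: "poly_apply M (monom c k) v = c *s (((*v) M ^^ k) v)"
  by (induction k) (simp_all add: monom_0 monom_Suc vector_scalar_commute)

lemma poly_apply_commute: "poly_apply M p (M *v v) = M *v poly_apply M p v"
  by (induction p) (simp_all add: matrix_vector_right_distrib vector_scalar_commute)

lemma poly_apply_diff_right: "poly_apply M p (v - w) = poly_apply M p v - poly_apply M p w"
  by (induction p) (simp_all add: matrix_vector_mult_diff_distrib vec.scale_right_diff_distrib)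

lemma poly_apply_scale_right: "poly_apply M p (c *s v) = c *s poly_apply M p v"
  by (induction p)
     (simp_all add: vector_scalar_commute vec.scale_right_distrib vector_smult_assoc mult.commute)

text \<open>Adding up the recursion bounds each partial sum s by
  \<open>a 0 + r * s + suminf b\<close>; since \<open>r < 1\<close>, this can be solved for
  s.\<close>

lemma summable_if_linear_recursion:
  fixes a b :: "nat \<Rightarrow> real"
  assumes r: "0 \<le> r" "r < 1" and a: "\<And>k. 0 \<le> a k" and b: "\<And>k. 0 \<le> b k" "summable b"
    and rec: "\<And>k. a (Suc k) \<le> r * a k + b k"
  shows "summable a"
proof (rule summableI_nonneg_bounded[OF a])
  fix n
  have "sum a {..<n} \<le> sum a {..<Suc n}" using a by simp
  also have "\<dots> = a 0 + (\<Sum>k<n. a (Suc k))" by (rule sum.lessThan_Suc_shift)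
  also have "\<dots> \<le> a 0 + (\<Sum>k<n. r * a k + b k)" by (intro add_left_mono sum_mono rec)
  also have "\<dots> = a 0 + r * sum a {..<n} + sum b {..<n}" by (simp add: sum.distrib sum_distrib_left)
  also have "\<dots> \<le> a 0 + r * sum a {..<n} + suminf b" using sum_le_suminf[OF b(2), of "{..<n}"] b by simp
  finally show "sum a {..<n} \<le> (a 0 + suminf b) / (1 - r)"
    using r by (simp add: field_simps)
qed

lemma norm_vector_scale_complex: "norm (c *s (v::complex^'n)) = cmod c * norm v"
  by (simp add: norm_vec_def norm_mult L2_set_right_distrib)

lemma iterate_minus_scale:
  "((*v) M ^^ k) (M *v v - c *s v) = ((*v) M ^^ Suc k) v - c *s ((*v) M ^^ k) (v::complex^'n)"
  by (induction k) (simp_all add: matrix_vector_mult_diff_distrib vector_scalar_commute)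

text \<open>If \<open>p = (X - r) q\<close> annihilates \<open>v\<close>, then either \<open>q\<close> already does, or \<open>q(M) v\<close> is an
  eigenvector for \<open>r\<close>; in the latter case \<open>q\<close> annihilates \<open>M v - r v\<close> and \<open>|r| < 1\<close>.\<close>
lemma summable_iterates_if_annihilated:
  fixes M :: "complex^'n^'n"
  assumes eig: "\<And>c v. v \<noteq> 0 \<Longrightarrow> M *v v = c *s v \<Longrightarrow> cmod c < 1"
  shows "p \<noteq> 0 \<Longrightarrow> poly_apply M p v = 0 \<Longrightarrow> summable (\<lambda>k. norm (((*v) M ^^ k) v))"
proof (induction "degree p" arbitrary: p v rule: less_induct)
  case less
  show ?case
  proof (cases "degree p = 0")
    \<comment> \<open>A nonzero constant polynomial annihilates only the zero vector.\<close>
    case True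
    then obtain c where "p = [:c:]" by (meson degree_eq_zeroE)
    with less.prems have "v = 0" by simp
    have "((*v) M ^^ k) 0 = 0" for k by (induction k) simp_all
    with \<open>v = 0\<close> show ?thesis by simp
  next
    case False
    then obtain r where "poly p r = 0"
      using fundamental_theorem_of_algebra[of p] constant_degree[of p] by auto
    then obtain q where p: "p = [:- r, 1:] * q" by (metis dvdE poly_eq_0_iff_dvd)
    have q: "q \<noteq> 0" using less.prems p by auto
    have deg: "degree q < degree p"
      unfolding p using q by (subst degree_mult_eq) auto
    have ann: "M *v poly_apply M q v = r *s poly_apply M q v"
      using less.prems(2) unfolding p
      by (simp add: poly_apply_diff poly_apply_smult)
    show ?thesis
    proof (cases "poly_apply M q v = 0")
      case True
      then show ?thesis using less.hyps[OF deg q] by blast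
    next
      case False
      then have r: "cmod r < 1" using eig ann by blast
      let ?v = "M *v v - r *s v"
      have "poly_apply M q ?v = 0"
        by (simp add: poly_apply_diff_right poly_apply_commute poly_apply_scale_right ann)
      then have sum: "summable (\<lambda>k. norm (((*v) M ^^ k) ?v))"
        using less.hyps[OF deg q] by blast
      \<comment> \<open>Powers of \<open>M\<close> commute with M - r, so M^(k+1) v = r M^k v + M^k
        \<open>?v\<close>. For the norms this is a recursion with factor \<open>cmod r\<close> and a
        summable perturbation.\<close>
      show ?thesis
      proof (rule summable_if_linear_recursion[OF _ r _ _ sum])
        fix k
        have "((*v) M ^^ Suc k) v = r *s ((*v) M ^^ k) v + ((*v) M ^^ k) ?v"
          unfolding iterate_minus_scale by simp
        then show "norm (((*v) M ^^ Suc k) v)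
            \<le> cmod r * norm (((*v) M ^^ k) v) + norm (((*v) M ^^ k) ?v)"
          by (metis norm_triangle_ineq norm_vector_scale_complex)
      qed simp_all
    qed
  qed
qed

text \<open>The iterates v, M v, ..., M^N v, with N the real dimension of the space, are N + 1
  vectors and hence linearly dependent; the coefficients of a dependency form the
  polynomial.\<close>

lemma annihilating_poly_exists:
  fixes M :: "complex^'n^'n"
  obtains p where "p \<noteq> 0" "poly_apply M p v = 0"
proof -
  let ?f = "\<lambda>k. ((*v) M ^^ k) v" and ?N = "DIM(complex^'n)"
  show thesis
  proof (cases "inj_on ?f {..?N}")
    \<comment> \<open>\<open>dependent\<close> speaks of sets, so repeated iterates are treated
      apart: if the i-th and j-th iterates agree, X^i - X^j annihilates \<open>v\<close>.\<close>
    case False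
    then obtain i j where ij: "i \<noteq> j" "?f i = ?f j" by (auto simp: inj_on_def)
    let ?p = "monom 1 i + monom (-1) j :: complex poly"
    have "coeff ?p i = 1" using ij by simp
    then have "?p \<noteq> 0" by (metis coeff_0 zero_neq_one)
    moreover have "poly_apply M ?p v = 0"
      using ij by (simp add: poly_apply_add poly_apply_monom vector_sneg_minus1[symmetric])
    ultimately show thesis by (rule that)
  next
    case True
    then have "dependent (?f ` {..?N})"
      by (intro dependent_biggerset) (simp add: card_image)
    then obtain u where u: "\<exists>w\<in>?f ` {..?N}. u w \<noteq> 0" "(\<Sum>w\<in>?f ` {..?N}. u w *\<^sub>R w) = 0"
      by (auto simp: dependent_finite)
    let ?c = "\<lambda>k. complex_of_real (u (?f k))"
    let ?p = "\<Sum>k\<le>?N. monom (?c k) k"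
    obtain k where k: "k \<le> ?N" "u (?f k) \<noteq> 0" using u by auto
    have "coeff ?p k = ?c k"
      using k by (simp add: coeff_sum)
    then have "?p \<noteq> 0" using k by (metis coeff_0 of_real_eq_0_iff)
    moreover have "poly_apply M ?p v = (\<Sum>k\<le>?N. u (?f k) *\<^sub>R ?f k)"
      unfolding poly_apply_sum poly_apply_monom
      by (intro sum.cong refl) (simp add: vec_eq_iff scaleR_conv_of_real[where 'a=complex])
    moreover have "\<dots> = 0" using u(2) True by (simp add: sum.reindex)
    ultimately show thesis using that by simp
  qed
qed

section \<open>From complex to real iterates\<close>

lemma norm_cvec: "norm (\<chi> i. complex_of_real ((x::real^'n) $ i)) = norm x"
  by (simp add: norm_vec_def)

lemma cmat_mult_cvec:
  "cmat M *v (\<chi> i. complex_of_real (x $ i)) = (\<chi> i. complex_of_real ((M *v x) $ i))"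
  by (simp add: cmat_def matrix_vector_mult_def vec_eq_iff)

lemma matpow_cvec:
  "(((*v) (cmat M)) ^^ k) (\<chi> i. complex_of_real (x $ i)) = (\<chi> i. complex_of_real ((matpow M k *v x) $ i))"
  by (induction k) (simp_all add: matrix_vector_mul_assoc[symmetric] cmat_mult_cvec)

text \<open>Real vectors embed isometrically into complex ones, and \<open>cmat M\<close> acts on
  embedded vectors as \<open>M\<close> does, so the complex result, whose proof needs eigenvalues,
  carries over to real iterates.\<close>

lemma schur_stable_summable:
  assumes "schur_stable M"
  shows "summable (\<lambda>k. norm (matpow M k *v x))"
proof -
  let ?x = "\<chi> i. complex_of_real (x $ i)"
  obtain p where "p \<noteq> 0" "poly_apply (cmat M) p ?x = 0"
    by (rule annihilating_poly_exists)
  then have "summable (\<lambda>k. norm (((*v) (cmat M) ^^ k) ?x))"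
    using assms by (intro summable_iterates_if_annihilated) (auto simp: schur_stable_def)
  then show ?thesis by (simp add: matpow_cvec norm_cvec)
qed

text \<open>Expanding \<open>x\<close> in the standard basis makes summability uniform in
  \<open>x\<close>: \<open>a k\<close> is the sum of the norms of the images of the basis vectors
  under the k-th power.\<close>

lemma schur_stable_bound:
  fixes M :: "real^'a^'a"
  assumes "schur_stable M"
  obtains a where "summable a" "\<And>k. 0 \<le> a k" "\<And>k x. norm (matpow M k *v x) \<le> a k * norm x"
proof
  let ?a = "\<lambda>k. \<Sum>b\<in>Basis. norm (matpow M k *v b)"
  show "summable ?a" by (intro summable_sum schur_stable_summable assms)
  show "0 \<le> ?a k" for k by (intro sum_nonneg) simp
  show "norm (matpow M k *v x) \<le> ?a k * norm x" for k x
  proof -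
    have "matpow M k *v x = matpow M k *v (\<Sum>b\<in>Basis. (x \<bullet> b) *\<^sub>R b)"
      by (simp only: euclidean_representation)
    also have "\<dots> = (\<Sum>b\<in>Basis. (x \<bullet> b) *\<^sub>R (matpow M k *v b))"
      by (simp add: linear_sum[OF matrix_vector_mul_linear] matrix_vector_mult_scaleR)
    also have "norm \<dots> \<le> (\<Sum>b\<in>Basis. norm (matpow M k *v b) * norm x)"
      proof (rule sum_norm_le)
      fix b :: "real^'a" assume "b \<in> Basis"
      then have "\<bar>x \<bullet> b\<bar> * norm (matpow M k *v b) \<le> norm x * norm (matpow M k *v b)"
        by (intro mult_right_mono Basis_le_norm) simp_all
      then show "norm ((x \<bullet> b) *\<^sub>R (matpow M k *v b)) \<le> norm (matpow M k *v b) * norm x"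
        by (simp add: mult.commute)
    qed
    finally show ?thesis by (simp add: sum_distrib_right)
  qed
qed

text \<open>A vector fixed by \<open>M\<close> has a constant orbit, whose norms are summable only
  if the vector is zero; so \<open>mat 1 - M\<close> has trivial kernel.\<close>

lemma schur_stable_invertible:
  assumes "schur_stable M"
  shows "invertible (mat 1 - M)"
proof -
  have "x = 0" if "(mat 1 - M) *v x = 0" for x
  proof -
    from that have "M *v x = x" by (simp add: matrix_vector_mult_diff_rdistrib)
    then have "matpow M k *v x = x" for k
      by (induction k) (simp_all add: matrix_vector_mul_assoc[symmetric])
    with schur_stable_summable[OF assms, of x] have "summable (\<lambda>k::nat. norm x)" by simp
    then show "x = 0" by (simp add: summable_const_iff)
  qed
  then show ?thesis by (simp add: invertible_left_inverse matrix_left_invertible_ker)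
qed

subsection \<open>Uniqueness of stationary laws\<close>

lemma borel_measurable_matrix_vector_mult [measurable (raw)]:
  fixes N :: "real^'n^'m"
  assumes [measurable]: "f \<in> borel_measurable M"
  shows "(\<lambda>x. N *v f x) \<in> borel_measurable M"
proof -
  have [measurable]: "(*v) N \<in> borel_measurable borel"
    by (intro borel_measurable_continuous_onI linear_continuous_on matrix_vector_mul_bounded_linear)
  show ?thesis by measurable
qed

text \<open>The indicator of a closed set is the pointwise limit of bounded Lipschitz functions of
  the distance to the set, and the closed sets form an intersection-stable generator of the Borel
  sets.\<close>

lemma prob_measure_eqI_lipschitz:
  fixes \<mu> \<nu> :: "'a::metric_space measure"
  assumes "prob_space \<mu>" "prob_space \<nu>" and sets: "sets \<mu> = sets borel" "sets \<nu> = sets borel"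
    and eq: "\<And>f L. (\<And>x. 0 \<le> f x) \<Longrightarrow> (\<And>x. f x \<le> 1) \<Longrightarrow> 0 \<le> L \<Longrightarrow> (\<And>x y. \<bar>f x - f y\<bar> \<le> L * dist x y)
       \<Longrightarrow> f \<in> borel_measurable borel \<Longrightarrow> (\<integral>x. f x \<partial>\<mu>) = (\<integral>x. f x \<partial>\<nu>)"
  shows "\<mu> = \<nu>"
proof -
  interpret mu: prob_space \<mu> by fact
  interpret nu: prob_space \<nu> by fact
  note [measurable_cong] = sets
  have closed_eq: "emeasure \<mu> C = emeasure \<nu> C" if C: "closed C" for C
  proof (cases "C = {}")
    \<comment> \<open>\<open>infdist\<close> to the empty set is 0 by convention, so for empty
      \<open>C\<close> the functions below would be constantly 1 and would not approximate the
      indicator.\<close>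
    case False
    define f where "f k x = max 0 (1 - real k * infdist x C)" for k x
    have f01: "0 \<le> f k x" "f k x \<le> 1" for k x
      by (auto simp: f_def infdist_nonneg)
    have lip: "\<bar>f k x - f k y\<bar> \<le> real k * dist x y" for k x y
    proof -
      have "\<bar>f k x - f k y\<bar> \<le> \<bar>real k * infdist x C - real k * infdist y C\<bar>"
        unfolding f_def by linarith
      also have "\<dots> = real k * \<bar>infdist x C - infdist y C\<bar>"
        by (simp add: abs_mult right_diff_distrib[symmetric])
      also have "\<dots> \<le> real k * dist x y"
        by (intro mult_left_mono infdist_triangle_abs) simp
      finally show ?thesis .
    qed
    have meas [measurable]: "f k \<in> borel_measurable borel" for k
      unfolding f_def
      by (intro borel_measurable_continuous_onI continuous_intros)
    have lim: "(\<lambda>k. f k x) \<longlonglongrightarrow> indicator C x" for x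
    proof (cases "x \<in> C")
      case True
      then have "infdist x C = 0" by simp
      then show ?thesis using True by (simp add: f_def)
    next
      case False
      then have pos: "infdist x C > 0"
        using C \<open>C \<noteq> {}\<close> in_closed_iff_infdist_zero[of C x] infdist_nonneg[of x C] by simp
      then obtain N where N: "real N * infdist x C > 1" using ex_less_of_nat_mult by blast
      have "f k x = 0" if "k \<ge> N" for k
      proof -
        have "real N * infdist x C \<le> real k * infdist x C"
          using that pos by (intro mult_right_mono) auto
        with N show ?thesis by (simp add: f_def)
      qed
      then have "eventually (\<lambda>k. f k x = 0) sequentially"
        by (auto simp: eventually_sequentially)
      then show ?thesis using False by (simp add: tendsto_eventually)
    qed
    have [measurable]: "C \<in> sets borel" using C by simp
    have "(\<lambda>k. \<integral>x. f k x \<partial>\<mu>) \<longlonglongrightarrow> (\<integral>x. indicator C x \<partial>\<mu>)"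
      using lim f01 by (intro integral_dominated_convergence[where w="\<lambda>_. 1"]) auto
    moreover have "(\<lambda>k. \<integral>x. f k x \<partial>\<nu>) \<longlonglongrightarrow> (\<integral>x. indicator C x \<partial>\<nu>)"
      using lim f01 by (intro integral_dominated_convergence[where w="\<lambda>_. 1"]) auto
    moreover have "(\<integral>x. f k x \<partial>\<mu>) = (\<integral>x. f k x \<partial>\<nu>)" for k
      by (rule eq[of _ "real k"]) (auto simp: f01 lip)
    ultimately have "(\<integral>x. indicator C x \<partial>\<mu>) = (\<integral>x. indicator C x \<partial>\<nu> :: real)"
      using LIMSEQ_unique by simp
    then show ?thesis
      using C sets by (simp add: mu.emeasure_eq_measure nu.emeasure_eq_measure space_borel sets_eq_imp_space_eq[OF sets(1)] sets_eq_imp_space_eq[OF sets(2)])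
  qed simp
  have sb: "sets (borel :: 'a measure) = sigma_sets UNIV (Collect closed)"
    by (simp add: borel_eq_closed)
  show ?thesis
    by (rule measure_eqI_generator_eq[of "Collect closed" UNIV _ _ "\<lambda>_. UNIV"])
       (auto simp: Int_stable_def closed_eq sets sb)
qed

text \<open>\<open>matpow\<close> gains factors on the left, while iterating the transition operator
  produces them on the right.\<close>

lemma matpow_mult_commute: "matpow M k ** M = M ** matpow M k"
  by (induction k) (simp_all add: matrix_mul_assoc[symmetric])

text \<open>The witness \<open>g\<close> is \<open>T^k f\<close> for the transition operator \<open>(T f) x = \<integral>w. f (N x + c + E w)\<close>,
  which preserves integrals against stationary laws.\<close>
lemma transition_operator_iterate:
  fixes N :: "real^'n^'n" and E :: "real^'w^'n"
  assumes "prob_space \<mu>W" and W_sets: "sets \<mu>W = sets borel"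
    and f01: "\<And>x. 0 \<le> f x" "\<And>x. f x \<le> 1" and f [measurable]: "f \<in> borel_measurable borel"
    and L: "0 \<le> L" and lip: "\<And>x y. \<bar>f x - f y\<bar> \<le> L * norm (x - y)"
  obtains g where "g \<in> borel_measurable borel" "\<And>x. 0 \<le> g x" "\<And>x. g x \<le> 1"
    "\<And>x y. \<bar>g x - g y\<bar> \<le> L * norm (matpow N k *v (x - y))"
    "\<And>\<mu>. prob_space \<mu> \<Longrightarrow> sets \<mu> = sets borel \<Longrightarrow>
       distr (\<mu> \<Otimes>\<^sub>M \<mu>W) borel (\<lambda>(x, w). N *v x + c + E *v w) = \<mu> \<Longrightarrow> (\<integral>x. g x \<partial>\<mu>) = (\<integral>x. f x \<partial>\<mu>)"
proof (induction k arbitrary: thesis)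
  case 0
  show ?case by (rule 0[of f]) (simp_all add: f01 lip)
next
  case (Suc k)
  interpret W: prob_space \<mu>W by fact
  note [measurable_cong] = W_sets
  obtain g where g [measurable]: "g \<in> borel_measurable borel" and g01: "\<And>x. 0 \<le> g x" "\<And>x. g x \<le> 1"
    and gl: "\<And>x y. \<bar>g x - g y\<bar> \<le> L * norm (matpow N k *v (x - y))"
    and gi: "\<And>\<mu>. prob_space \<mu> \<Longrightarrow> sets \<mu> = sets borel \<Longrightarrow>
       distr (\<mu> \<Otimes>\<^sub>M \<mu>W) borel (\<lambda>(x, w). N *v x + c + E *v w) = \<mu> \<Longrightarrow> (\<integral>x. g x \<partial>\<mu>) = (\<integral>x. f x \<partial>\<mu>)"
    using Suc.IH by blast
  define h where "h x = (\<integral>w. g (N *v x + c + E *v w) \<partial>\<mu>W)" for x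
  have int: "integrable \<mu>W (\<lambda>w. g (N *v x + c + E *v w))" for x
    by (rule W.integrable_const_bound[where B=1]) (auto simp: g01)
  show ?case
  proof (rule Suc.prems)
    show "h \<in> borel_measurable borel" unfolding h_def by measurable
    show "0 \<le> h x" for x unfolding h_def by (simp add: g01)
    show "h x \<le> 1" for x
    proof -
      have "h x \<le> (\<integral>w. 1 \<partial>\<mu>W)" unfolding h_def by (intro integral_mono int) (auto simp: g01)
      then show ?thesis by (simp add: W.prob_space)
    qed
    show "\<bar>h x - h y\<bar> \<le> L * norm (matpow N (Suc k) *v (x - y))" for x y
    proof -
      have "\<bar>h x - h y\<bar> = \<bar>\<integral>w. g (N *v x + c + E *v w) - g (N *v y + c + E *v w) \<partial>\<mu>W\<bar>"
        unfolding h_def by (simp add: int)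
      also have "\<dots> \<le> (\<integral>w. \<bar>g (N *v x + c + E *v w) - g (N *v y + c + E *v w)\<bar> \<partial>\<mu>W)"
        by (rule integral_abs_bound)
      \<comment> \<open>The common shift \<open>c + E *v w\<close> cancels in the difference of the
        two arguments, so the bound does not depend on \<open>w\<close>.\<close>
      also have "\<dots> \<le> (\<integral>w. L * norm (matpow N k *v (N *v (x - y))) \<partial>\<mu>W)"
      proof (intro integral_mono)
        fix w
        show "\<bar>g (N *v x + c + E *v w) - g (N *v y + c + E *v w)\<bar> \<le> L * norm (matpow N k *v (N *v (x - y)))"
          using gl[of "N *v x + c + E *v w" "N *v y + c + E *v w"]
          by (simp add: matrix_vector_mult_diff_distrib)
      qed (auto intro!: int integrable_abs Bochner_Integration.integrable_diff)
      also have "\<dots> = L * norm (matpow N (Suc k) *v (x - y))"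
        by (simp add: W.prob_space matrix_vector_mul_assoc matpow_mult_commute)
      finally show ?thesis .
    qed
    fix \<mu> :: "(real^'n) measure"
    assume mu: "prob_space \<mu>" "sets \<mu> = sets borel"
      and st: "distr (\<mu> \<Otimes>\<^sub>M \<mu>W) borel (\<lambda>(x, w). N *v x + c + E *v w) = \<mu>"
    interpret mu: prob_space \<mu> by fact
    interpret P: pair_prob_space \<mu> \<mu>W ..
    note [measurable_cong] = mu(2)
    \<comment> \<open>Fubini turns the integral of \<open>h\<close> into the integral of
      \<open>g\<close> under the law of the next state, which is \<mu> again.\<close>
    have "(\<integral>x. h x \<partial>\<mu>) = (\<integral>z. g (N *v fst z + c + E *v snd z) \<partial>(\<mu> \<Otimes>\<^sub>M \<mu>W))"
      unfolding h_def
      by (subst P.integral_fst'[symmetric])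
         (auto intro!: P.integrable_const_bound[where B=1] simp: g01)
    also have "\<dots> = (\<integral>x. g x \<partial>distr (\<mu> \<Otimes>\<^sub>M \<mu>W) borel (\<lambda>(x, w). N *v x + c + E *v w))"
      by (subst integral_distr) (auto simp: split_beta')
    also have "\<dots> = (\<integral>x. f x \<partial>\<mu>)" using gi[OF mu st] st by simp
    finally show "(\<integral>x. h x \<partial>\<mu>) = (\<integral>x. f x \<partial>\<mu>)" .
  qed
qed

text \<open>The k-th iterate of \<open>f\<close> has Lipschitz constant at most
  \<open>L * a k\<close>, so it is nearly constant. Finite first moments control the error, which
  vanishes as \<open>a k\<close> tends to 0.\<close>

lemma stationary_law_unique:
  fixes N :: "real^'n^'n" and E :: "real^'w^'n"
  assumes stable: "schur_stable N" and W: "prob_space \<mu>W" "sets \<mu>W = sets borel"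
    and mu1: "prob_space \<mu>1" "sets \<mu>1 = sets borel" "integrable \<mu>1 norm"
      "distr (\<mu>1 \<Otimes>\<^sub>M \<mu>W) borel (\<lambda>(x, w). N *v x + c + E *v w) = \<mu>1"
    and mu2: "prob_space \<mu>2" "sets \<mu>2 = sets borel" "integrable \<mu>2 norm"
      "distr (\<mu>2 \<Otimes>\<^sub>M \<mu>W) borel (\<lambda>(x, w). N *v x + c + E *v w) = \<mu>2"
  shows "\<mu>1 = \<mu>2"
proof (rule prob_measure_eqI_lipschitz[OF mu1(1) mu2(1) mu1(2) mu2(2)])
  fix f :: "real^'n \<Rightarrow> real" and L
  assume f: "\<And>x. 0 \<le> f x" "\<And>x. f x \<le> 1" and L: "0 \<le> L"
    and lip: "\<And>x y. \<bar>f x - f y\<bar> \<le> L * dist x y" and fm: "f \<in> borel_measurable borel"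
  obtain a where a: "summable a" "\<And>k. 0 \<le> a k" "\<And>k x. norm (matpow N k *v x) \<le> a k * norm x"
    using schur_stable_bound[OF stable] by blast
  let ?I = "\<lambda>\<mu>. \<integral>x. f x \<partial>\<mu>" and ?J = "\<lambda>\<mu>. \<integral>x. norm x \<partial>\<mu>"
  have bound: "\<bar>?I \<mu>1 - ?I \<mu>2\<bar> \<le> L * a k * (?J \<mu>1 + ?J \<mu>2)" for k
  proof -
    obtain g where g: "g \<in> borel_measurable borel" and g01: "\<And>x. 0 \<le> g x" "\<And>x. g x \<le> 1"
      and gl: "\<And>x y. \<bar>g x - g y\<bar> \<le> L * norm (matpow N k *v (x - y))"
      and gi: "\<And>\<mu>. prob_space \<mu> \<Longrightarrow> sets \<mu> = sets borel \<Longrightarrow>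
       distr (\<mu> \<Otimes>\<^sub>M \<mu>W) borel (\<lambda>(x, w). N *v x + c + E *v w) = \<mu> \<Longrightarrow> (\<integral>x. g x \<partial>\<mu>) = (\<integral>x. f x \<partial>\<mu>)"
      using transition_operator_iterate[OF W f fm L lip[unfolded dist_norm], of N k c E] by blast
    \<comment> \<open>The same \<open>g\<close> serves both laws, so \<open>g 0\<close> is a common
      reference value for the two integrals.\<close>
    have *: "\<bar>?I \<mu> - g 0\<bar> \<le> L * a k * ?J \<mu>"
      if mu: "prob_space \<mu>" "sets \<mu> = sets borel" "integrable \<mu> norm"
        "distr (\<mu> \<Otimes>\<^sub>M \<mu>W) borel (\<lambda>(x, w). N *v x + c + E *v w) = \<mu>" for \<mu>
    proof -
      interpret mu: prob_space \<mu> by fact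
      note [measurable_cong] = mu(2) and [measurable] = g
      have int: "integrable \<mu> g"
        by (rule mu.integrable_const_bound[where B=1]) (auto simp: g01)
      have "\<bar>?I \<mu> - g 0\<bar> = \<bar>\<integral>x. g x - g 0 \<partial>\<mu>\<bar>"
        using gi[OF mu(1,2,4)] int by (simp add: mu.prob_space)
      also have "\<dots> \<le> (\<integral>x. \<bar>g x - g 0\<bar> \<partial>\<mu>)" by (rule integral_abs_bound)
      also have "\<dots> \<le> (\<integral>x. (L * a k) * norm x \<partial>\<mu>)"
      proof (intro integral_mono)
        fix x
        have "L * norm (matpow N k *v x) \<le> L * (a k * norm x)"
          using L a(3) by (intro mult_left_mono)
        with gl[of x 0] show "\<bar>g x - g 0\<bar> \<le> L * a k * norm x" by simp
      qed (use int mu(3) in auto)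
      finally show ?thesis by simp
    qed
    from *[OF mu1] *[OF mu2] show ?thesis by (simp add: distrib_left)
  qed
  have "(\<lambda>k. L * a k * (?J \<mu>1 + ?J \<mu>2)) \<longlonglongrightarrow> L * 0 * (?J \<mu>1 + ?J \<mu>2)"
    by (intro tendsto_intros summable_LIMSEQ_zero a)
  then have "\<bar>?I \<mu>1 - ?I \<mu>2\<bar> \<le> L * 0 * (?J \<mu>1 + ?J \<mu>2)"
    by (rule LIMSEQ_le_const) (use bound in auto)
  then show "?I \<mu>1 = ?I \<mu>2" by simp
qed

subsection \<open>Completing the square\<close>

lemma inner_mult_transpose: "(A *v x) \<bullet> y = x \<bullet> (transpose A *v (y::real^'m))" for A :: "real^'n^'m"
  by (metis dot_lmul_matrix inner_commute transpose_matrix_vector)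

text \<open>The adjoint rule for \<open>y v* A\<close>, the simp normal form of
  \<open>transpose A *v y\<close>.\<close>

lemma inner_vector_matrix: "x \<bullet> (y v* A) = (A *v x) \<bullet> y" for A :: "real^'n^'m"
  by (metis dot_lmul_matrix inner_commute)

lemma minus_matrix_vector_mult: "(- A) *v x = - (A *v x)" for A :: "real^'n^'m"
  by (simp add: vec_eq_iff matrix_vector_mult_def sum_negf)

lemma matrix_vector_mult_minus: "A *v (- x) = - (A *v x)" for A :: "real^'n^'m"
  by (simp add: vec_eq_iff matrix_vector_mult_def sum_negf)

lemma mult_matrix_inv: "invertible M \<Longrightarrow> M *v (matrix_inv M *v x) = x" for M :: "real^'n^'n"
  unfolding invertible_def matrix_inv_def
  by (drule someI_ex) (simp add: matrix_vector_mul_assoc)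

lemma pd_add_psd: "pd R \<Longrightarrow> psd S \<Longrightarrow> pd (R + S)"
  by (simp add: pd_def psd_def matrix_vector_mult_add_rdistrib inner_add_right add_pos_nonneg
      transpose_def vec_eq_iff)

lemma psd_congruence: "psd P \<Longrightarrow> psd (transpose B ** P ** B)"
  by (simp add: psd_def matrix_transpose_mul matrix_mul_assoc matrix_vector_mul_assoc[symmetric]
      inner_vector_matrix)

lemma pd_invertible:
  fixes M :: "real^'n^'n"
  assumes "pd M" shows "invertible M"
proof -
  have "x = 0" if "M *v x = 0" for x
    using assms that by (metis inner_zero_right less_irrefl pd_def)
  then show ?thesis by (simp add: invertible_left_inverse matrix_left_invertible_ker)
qed

locale lq_riccati =
  fixes A :: "real^'nx^'nx" and B :: "real^'nu^'nx" and E :: "real^'nw^'nx"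
    and Q :: "real^'nx^'nx" and R :: "real^'nu^'nu"
    and P :: "real^'nx^'nx" and G :: "real^'nw^'nx"
  assumes R: "pd R" and P_psd: "psd P" and P_dare: "dare A B Q R P"
    and P_stab: "schur_stable (Acl A B R P)"
    and G_eq: "G = transpose (Acl A B R P) ** (P ** E + G)"
begin

abbreviation "M \<equiv> R + transpose B ** P ** B"
abbreviation "K \<equiv> gainK A B R P"
abbreviation "F \<equiv> gainF B R P E G"
abbreviation "Ac \<equiv> Acl A B R P"

lemma M_pd: "pd M"
  by (rule pd_add_psd[OF R psd_congruence[OF P_psd]])

lemma M_cancel: "M *v (matrix_inv M *v x) = x"
  by (rule mult_matrix_inv[OF pd_invertible[OF M_pd]])

lemma M_sym: "x \<bullet> (M *v y) = (M *v x) \<bullet> y"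
  using M_pd unfolding inner_mult_transpose pd_def by simp

lemma P_sym: "x \<bullet> (P *v y) = (P *v x) \<bullet> y"
  using P_psd unfolding inner_mult_transpose psd_def by simp

lemma K_mult: "K *v x = - (matrix_inv M *v (transpose B *v (P *v (A *v x))))"
  unfolding gainK_def minus_matrix_vector_mult matrix_vector_mul_assoc matrix_mul_assoc ..

lemma F_mult: "F *v w = - (matrix_inv M *v (transpose B *v (P *v (E *v w) + G *v w)))"
  unfolding gainF_def minus_matrix_vector_mult
  by (simp add: matrix_vector_mult_add_rdistrib matrix_vector_mul_assoc[symmetric]
      del: transpose_matrix_vector)

text \<open>Multiplying a gain by \<open>M\<close> clears the inverse; in this form the gains enter
  the completed square.\<close>

lemma M_K: "M *v (K *v x) = - (transpose B *v (P *v (A *v x)))"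
  unfolding K_mult matrix_vector_mult_minus M_cancel ..

lemma M_F: "M *v (F *v w) = - (transpose B *v (P *v (E *v w) + G *v w))"
  unfolding F_mult matrix_vector_mult_minus M_cancel ..

lemma Acl_mult: "Ac *v x = A *v x + B *v (K *v x)"
  by (simp add: Acl_def matrix_vector_mult_add_rdistrib matrix_vector_mul_assoc)

text \<open>The correction term of the Riccati equation is the quadratic form of \<open>M\<close> at
  \<open>K *v x\<close>, because \<open>M_K\<close> replaces B^T P A by - M K.\<close>

lemma riccati_form:
  "x \<bullet> (P *v x) = x \<bullet> (Q *v x) + (A *v x) \<bullet> (P *v (A *v x)) - (K *v x) \<bullet> (M *v (K *v x))"
proof -
  have "P *v x = Q *v x + transpose A *v (P *v (A *v x))
      - transpose A *v (P *v (B *v (matrix_inv M *v (transpose B *v (P *v (A *v x))))))"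
    by (subst P_dare[unfolded dare_def])
       (simp add: matrix_vector_mult_add_rdistrib matrix_vector_mult_diff_rdistrib
         matrix_vector_mult_diff_distrib matrix_vector_mul_assoc[symmetric])
  also have "matrix_inv M *v (transpose B *v (P *v (A *v x))) = - (K *v x)"
    by (simp add: K_mult)
  finally have "x \<bullet> (P *v x) = x \<bullet> (Q *v x) + (A *v x) \<bullet> (P *v (A *v x)) + (A *v x) \<bullet> (P *v (B *v (K *v x)))"
    by (simp add: inner_add_right inner_vector_matrix matrix_vector_mult_minus)
  also have "(A *v x) \<bullet> (P *v (B *v (K *v x))) = - ((K *v x) \<bullet> (M *v (K *v x)))"
    unfolding M_K inner_minus_right minus_minus inner_mult_transpose[symmetric]
    by (subst P_sym) (rule inner_commute)
  finally show ?thesis by simp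
qed

text \<open>The equation for \<open>G\<close> is tested against \<open>x\<close> and
  \<open>w\<close>, and the transposed closed-loop matrix moves to the left factor.\<close>

lemma G_form: "x \<bullet> (G *v w) = (A *v x + B *v (K *v x)) \<bullet> (P *v (E *v w) + G *v w)"
proof -
  have "G *v w = transpose Ac *v (P *v (E *v w) + G *v w)"
    by (subst G_eq) (simp add: matrix_vector_mult_add_rdistrib matrix_vector_mul_assoc matrix_add_ldistrib
      matrix_vector_right_distrib)
  then have "x \<bullet> (G *v w) = (Ac *v x) \<bullet> (P *v (E *v w) + G *v w)" by (metis inner_mult_transpose)
  then show ?thesis by (simp add: Acl_mult)
qed

text \<open>\<open>M\<close> collects the terms quadratic in \<open>u\<close>. By \<open>M_K\<close>
  and \<open>M_F\<close>, the terms linear in \<open>u\<close> are those of the expanded square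
  \<open>d \<bullet> (M *v d)\<close>. What is left is free of \<open>u\<close> and is matched by
  \<open>riccati_form\<close> and \<open>G_form\<close>.\<close>

lemma completion_of_square:
  fixes x u w
  defines "s \<equiv> A *v x + B *v u" and "d \<equiv> u - (K *v x + F *v w)"
  shows "x \<bullet> (Q *v x) + u \<bullet> (R *v u) + s \<bullet> (P *v s) + 2 * (s \<bullet> (P *v (E *v w) + G *v w))
      = x \<bullet> (P *v x) + 2 * (x \<bullet> (G *v w)) + d \<bullet> (M *v d) - (F *v w) \<bullet> (M *v (F *v w))"
proof -
  define h where "h = P *v (E *v w) + G *v w"
  define k where "k = K *v x"
  define f where "f = F *v w"
  have Mk: "y \<bullet> (M *v k) = - ((B *v y) \<bullet> (P *v (A *v x)))" for y
    unfolding k_def M_K by (simp add: inner_vector_matrix)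
  have Mf: "y \<bullet> (M *v f) = - ((B *v y) \<bullet> h)" for y
    unfolding f_def M_F h_def by (simp add: inner_vector_matrix)
  have sym: "k \<bullet> (M *v u) = u \<bullet> (M *v k)" "f \<bullet> (M *v u) = u \<bullet> (M *v f)" "f \<bullet> (M *v k) = k \<bullet> (M *v f)"
    by (metis M_sym inner_commute)+
  have "d \<bullet> (M *v d) = u \<bullet> (M *v u) + k \<bullet> (M *v k) + f \<bullet> (M *v f)
      - 2 * (u \<bullet> (M *v k)) - 2 * (u \<bullet> (M *v f)) + 2 * (k \<bullet> (M *v f))"
    unfolding d_def k_def[symmetric] f_def[symmetric]
    by (simp add: matrix_vector_mult_diff_distrib matrix_vector_right_distrib
      inner_diff_left inner_diff_right inner_add_left inner_add_right sym)
  moreover have "u \<bullet> (M *v u) = u \<bullet> (R *v u) + (B *v u) \<bullet> (P *v (B *v u))"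
    by (simp add: matrix_vector_mult_add_rdistrib inner_add_right inner_vector_matrix
      matrix_vector_mul_assoc[symmetric])
  moreover have "(A *v x) \<bullet> (P *v (B *v u)) = (B *v u) \<bullet> (P *v (A *v x))"
    by (metis P_sym inner_commute)
  ultimately show ?thesis
    using riccati_form[of x] G_form[of x w] Mk[of u] Mf[of u] Mf[of k]
    unfolding s_def k_def[symmetric] h_def[symmetric] f_def[symmetric]
    by (simp add: matrix_vector_right_distrib inner_add_left inner_add_right)
qed

end

subsection \<open>Cost of feasible laws\<close>

definition square_integrable :: "'a measure \<Rightarrow> ('a \<Rightarrow> 'b::euclidean_space) \<Rightarrow> bool" where
  "square_integrable M f \<longleftrightarrow> f \<in> borel_measurable M \<and> integrable M (\<lambda>x. (norm (f x))\<^sup>2)"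

lemma square_integrable_bound:
  assumes "square_integrable M f" "g \<in> borel_measurable M" "\<And>x. norm (g x) \<le> C * norm (f x)"
  shows "square_integrable M g"
proof -
  have "(norm (g x))\<^sup>2 \<le> C\<^sup>2 * (norm (f x))\<^sup>2" for x
    using power_mono[OF assms(3)[of x] norm_ge_zero, of 2] by (simp add: power_mult_distrib)
  note * = this
  have "integrable M (\<lambda>x. (norm (g x))\<^sup>2)"
    by (rule Bochner_Integration.integrable_bound[of M "\<lambda>x. C\<^sup>2 * (norm (f x))\<^sup>2"])
       (use assms * in \<open>auto simp: square_integrable_def\<close>)
  then show ?thesis using assms by (auto simp: square_integrable_def)
qed

lemma square_integrable_matrix_vector_mult:
  fixes N :: "real^'n^'m"
  assumes "square_integrable M f"
  shows "square_integrable M (\<lambda>x. N *v f x)"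
proof -
  obtain C where C: "\<And>x. norm (N *v x) \<le> norm x * C"
    using bounded_linear.bounded[OF matrix_vector_mul_bounded_linear[of N]] by blast
  show ?thesis
    using assms C by (intro square_integrable_bound[where C=C, OF assms])
      (auto simp: square_integrable_def mult.commute)
qed

lemma square_integrable_add:
  assumes "square_integrable M f" "square_integrable M g"
  shows "square_integrable M (\<lambda>x. f x + g x)"
proof -
  have "(norm (f x + g x))\<^sup>2 \<le> 2 * (norm (f x))\<^sup>2 + 2 * (norm (g x))\<^sup>2" for x
  proof -
    have "(norm (f x + g x))\<^sup>2 \<le> (norm (f x) + norm (g x))\<^sup>2"
      by (intro power_mono norm_triangle_ineq norm_ge_zero)
    also have "\<dots> \<le> 2 * (norm (f x))\<^sup>2 + 2 * (norm (g x))\<^sup>2"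
      using zero_le_power2[of "norm (f x) - norm (g x)"] by (simp add: power2_eq_square algebra_simps)
    finally show ?thesis .
  qed
  note * = this
  have "integrable M (\<lambda>x. (norm (f x + g x))\<^sup>2)"
    by (rule Bochner_Integration.integrable_bound[of M "\<lambda>x. 2 * (norm (f x))\<^sup>2 + 2 * (norm (g x))\<^sup>2"])
       (use assms * in \<open>auto simp: square_integrable_def\<close>)
  then show ?thesis using assms by (auto simp: square_integrable_def)
qed

lemma square_integrable_minus:
  "square_integrable M f \<Longrightarrow> square_integrable M (\<lambda>x. - f x)"
  by (simp add: square_integrable_def)

lemma square_integrable_diff:
  assumes "square_integrable M f" "square_integrable M g"
  shows "square_integrable M (\<lambda>x. f x - g x)"
  using square_integrable_add[OF assms(1) square_integrable_minus[OF assms(2)]] by simp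

lemma (in finite_measure) square_integrable_const: "square_integrable M (\<lambda>_. c)"
  by (simp add: square_integrable_def)

lemma square_integrable_inner:
  assumes "square_integrable M f" "square_integrable M g"
  shows "integrable M (\<lambda>x. f x \<bullet> g x)"
proof -
  have "\<bar>f x \<bullet> g x\<bar> \<le> (norm (f x))\<^sup>2 + (norm (g x))\<^sup>2" for x
  proof -
    have "\<bar>f x \<bullet> g x\<bar> \<le> norm (f x) * norm (g x)" by (rule Cauchy_Schwarz_ineq2)
    also have "\<dots> \<le> (norm (f x))\<^sup>2 + (norm (g x))\<^sup>2"
      using zero_le_power2[of "norm (f x) - norm (g x)"] mult_nonneg_nonneg[OF norm_ge_zero norm_ge_zero, of "f x" "g x"]
      unfolding power2_diff mult.assoc by linarith
    finally show ?thesis .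
  qed
  note * = this
  show ?thesis
    by (rule Bochner_Integration.integrable_bound[of M "\<lambda>x. (norm (f x))\<^sup>2 + (norm (g x))\<^sup>2"])
       (use assms * in \<open>auto simp: square_integrable_def\<close>)
qed

lemma (in finite_measure) square_integrable_imp_norm_integrable:
  "square_integrable M f \<Longrightarrow> integrable M (\<lambda>x. norm (f x))"
  unfolding square_integrable_def by (rule square_integrable_imp_integrable) auto

lemma (in finite_measure) square_integrable_integrable:
  "square_integrable M f \<Longrightarrow> integrable M f"
  using square_integrable_imp_norm_integrable[of f] integrable_norm_iff[of f M]
  by (auto simp: square_integrable_def)

lemmas square_integrable_intros =
  square_integrable_matrix_vector_mult square_integrable_add square_integrable_diff

section \<open>Average cost of a stationary law\<close>

locale lq_stationary = lq_riccati A B E Q R P G + W: prob_space \<mu>W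
  for A :: "real^'nx^'nx" and B :: "real^'nu^'nx" and E :: "real^'nw^'nx"
    and Q :: "real^'nx^'nx" and R :: "real^'nu^'nu"
    and P :: "real^'nx^'nx" and G :: "real^'nw^'nx" and \<mu>W :: "(real^'nw) measure" +
  assumes W_sets [measurable_cong]: "sets \<mu>W = sets borel"
    and W_L2: "integrable \<mu>W (\<lambda>w. (norm w)\<^sup>2)"
begin

abbreviation "m \<equiv> mean \<mu>W"

definition "opt_cost = wnorm2 \<mu>W (transpose E ** P ** E) + m \<bullet> (DeltaS B R P E G *v m)"

text \<open>This is V: the relative value function of the average-cost problem, whose Bellman
  equation has \<open>opt_cost\<close> as its constant.\<close>

definition "rel_value x = x \<bullet> (P *v x) + 2 * (x \<bullet> (G *v m))"

lemma W_square_integrable: "square_integrable \<mu>W (\<lambda>w. w)"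
  using W_L2 by (simp add: square_integrable_def)

lemma W_integrable: "integrable \<mu>W (\<lambda>w. w)"
  by (intro W.square_integrable_integrable W_square_integrable)

text \<open>The terms of \<open>DeltaS\<close> with E^T G and G^T E are transposes of each other and
  contribute equally, hence the factor 2.\<close>

lemma DeltaS_form:
  "m \<bullet> (DeltaS B R P E G *v m) = 2 * ((E *v m) \<bullet> (G *v m)) - (F *v m) \<bullet> (M *v (F *v m))"
proof -
  have "m \<bullet> (DeltaS B R P E G *v m) = m \<bullet> (transpose E *v (G *v m)) + m \<bullet> (transpose G *v (E *v m))
      - m \<bullet> (transpose F *v (M *v (F *v m)))"
    unfolding DeltaS_def
    by (simp only: matrix_vector_mult_add_rdistrib matrix_vector_mult_diff_rdistrib
      matrix_vector_mul_assoc[symmetric] inner_add_right inner_diff_right)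
  then show ?thesis
    unfolding inner_mult_transpose[symmetric] by (simp add: inner_commute)
qed

text \<open>With \<open>s\<close> held fixed, only two moments of the noise enter: terms linear in
  \<open>w\<close> integrate to their value at \<open>m\<close>, and the quadratic term gives the
  constant \<open>wnorm2\<close>.\<close>

lemma integral_value_next:
  "(\<integral>w. rel_value (s + E *v w) \<partial>\<mu>W) =
     s \<bullet> (P *v s) + 2 * (s \<bullet> (P *v (E *v m) + G *v m)) + 2 * ((E *v m) \<bullet> (G *v m))
     + wnorm2 \<mu>W (transpose E ** P ** E)"
proof -
  have quad: "w \<bullet> ((transpose E ** P ** E) *v w) = (E *v w) \<bullet> (P *v (E *v w))" for w
    by (simp add: matrix_vector_mul_assoc[symmetric] inner_vector_matrix)
  have expand: "rel_value (s + E *v w) = s \<bullet> (P *v s) + 2 * (s \<bullet> (G *v m)) + 2 * ((transpose E *v (P *v s)) \<bullet> w)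
      + 2 * ((transpose E *v (G *v m)) \<bullet> w) + w \<bullet> ((transpose E ** P ** E) *v w)" for w
    using P_sym[of s "E *v w"]
    by (simp add: rel_value_def quad matrix_vector_right_distrib inner_add_left inner_add_right
      inner_vector_matrix inner_commute[of _ w] inner_commute[of "P *v s"])
  have int: "integrable \<mu>W (\<lambda>w. v \<bullet> w)" "(\<integral>w. v \<bullet> w \<partial>\<mu>W) = v \<bullet> m" for v
    using W_integrable by (auto simp: mean_def)
  have "(\<integral>w. rel_value (s + E *v w) \<partial>\<mu>W) = s \<bullet> (P *v s) + 2 * (s \<bullet> (G *v m))
      + 2 * ((transpose E *v (P *v s)) \<bullet> m) + 2 * ((transpose E *v (G *v m)) \<bullet> m)
      + wnorm2 \<mu>W (transpose E ** P ** E)"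
    unfolding expand wnorm2_def
    using int square_integrable_inner[OF W_square_integrable
      square_integrable_matrix_vector_mult[OF W_square_integrable]]
    by (simp add: W.prob_space del: transpose_matrix_vector)
  then show ?thesis
    using P_sym[of s "E *v m"]
    by (simp add: inner_add_right inner_vector_matrix inner_commute[of _ m] inner_commute[of "P *v s"])
qed

text \<open>The completed square at \<open>w = m\<close> holds pointwise; after integration the two
  integrals of \<open>rel_value\<close> cancel, because the current and the next state have the same
  law.\<close>

lemma cost_feasible:
  assumes feas: "feasible A B E \<mu>W \<nu>"
  defines "d \<equiv> \<lambda>z. snd z - (K *v fst z + F *v m)"
  shows "integrable \<nu> (\<lambda>z. d z \<bullet> (M *v d z))"
    and "cost Q R \<nu> = opt_cost + (\<integral>z. d z \<bullet> (M *v d z) \<partial>\<nu>)"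
proof -
  have nu: "prob_space \<nu>" "sets \<nu> = sets borel"
    and L2: "integrable \<nu> (\<lambda>z. (norm (fst z))\<^sup>2)" "integrable \<nu> (\<lambda>z. (norm (snd z))\<^sup>2)"
    and st: "distr (\<nu> \<Otimes>\<^sub>M \<mu>W) borel (\<lambda>(z, w). A *v fst z + B *v snd z + E *v w) = distr \<nu> borel fst"
    using feas by (simp_all only: feasible_def)
  interpret nu: prob_space \<nu> by fact
  interpret pair: pair_prob_space \<nu> \<mu>W ..
  have [measurable_cong]: "sets \<nu> = sets (borel \<Otimes>\<^sub>M borel)" unfolding nu(2) borel_prod ..
  have sq: "square_integrable \<nu> fst" "square_integrable \<nu> snd"
    using L2 by (simp_all add: square_integrable_def)
  have sqd: "square_integrable \<nu> d"
    unfolding d_def by (intro square_integrable_intros sq nu.square_integrable_const)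
  show int_d: "integrable \<nu> (\<lambda>z. d z \<bullet> (M *v d z))"
    by (intro square_integrable_inner square_integrable_intros sqd)
  have [measurable]: "rel_value \<in> borel_measurable borel"
    unfolding rel_value_def by measurable
  have int_c: "integrable \<nu> (\<lambda>z. fst z \<bullet> (Q *v fst z) + snd z \<bullet> (R *v snd z))"
    by (intro Bochner_Integration.integrable_add square_integrable_inner square_integrable_intros sq)
  have int_v: "integrable \<nu> (\<lambda>z. rel_value (fst z))"
    unfolding rel_value_def
    by (intro Bochner_Integration.integrable_add integrable_mult_right
        square_integrable_inner square_integrable_intros nu.square_integrable_const sq)
  \<comment> \<open>Integrability of \<open>rel_value\<close> at the next state is not estimated
    directly; it is transported from the current state through the equality of laws.\<close>
  then have "integrable (distr \<nu> borel fst) rel_value" by (subst integrable_distr_eq) auto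
  then have "integrable (distr (\<nu> \<Otimes>\<^sub>M \<mu>W) borel (\<lambda>(z, w). A *v fst z + B *v snd z + E *v w)) rel_value"
    unfolding st .
  then have int_n: "integrable (\<nu> \<Otimes>\<^sub>M \<mu>W) (\<lambda>(z, w). rel_value (A *v fst z + B *v snd z + E *v w))"
    by (subst (asm) integrable_distr_eq) (auto simp: split_beta')
  let ?n = "\<lambda>z. \<integral>w. rel_value (A *v fst z + B *v snd z + E *v w) \<partial>\<mu>W"
  have "(\<integral>z. rel_value (fst z) \<partial>\<nu>) = (\<integral>x. rel_value x \<partial>distr \<nu> borel fst)"
    by (subst integral_distr) auto
  also have "\<dots> = (\<integral>z. (case z of (z, w) \<Rightarrow> rel_value (A *v fst z + B *v snd z + E *v w)) \<partial>(\<nu> \<Otimes>\<^sub>M \<mu>W))"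
    unfolding st[symmetric] by (subst integral_distr) (auto simp: split_beta')
  also have "\<dots> = (\<integral>z. ?n z \<partial>\<nu>)"
    using pair.integral_fst[OF int_n] by simp
  finally have stationary: "(\<integral>z. rel_value (fst z) \<partial>\<nu>) = (\<integral>z. ?n z \<partial>\<nu>)" .
  have int_n': "integrable \<nu> ?n" using pair.integrable_fst[OF int_n] by simp
  have "fst z \<bullet> (Q *v fst z) + snd z \<bullet> (R *v snd z) + ?n z
      = rel_value (fst z) + d z \<bullet> (M *v d z) + opt_cost" for z
    using completion_of_square[of "fst z" "snd z" m]
    unfolding integral_value_next unfolding d_def opt_cost_def DeltaS_form rel_value_def by simp
  then have "(\<integral>z. fst z \<bullet> (Q *v fst z) + snd z \<bullet> (R *v snd z) + ?n z \<partial>\<nu>)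
      = (\<integral>z. rel_value (fst z) + d z \<bullet> (M *v d z) + opt_cost \<partial>\<nu>)" by simp
  then show "cost Q R \<nu> = opt_cost + (\<integral>z. d z \<bullet> (M *v d z) \<partial>\<nu>)"
    unfolding cost_def using int_c int_n' int_v int_d stationary by (simp add: nu.prob_space)
qed

lemma M_form_pos: "x \<noteq> 0 \<Longrightarrow> 0 < x \<bullet> (M *v x)"
  using M_pd unfolding pd_def by blast

lemma M_form_nonneg: "0 \<le> x \<bullet> (M *v x)"
  using M_form_pos[of x] by (cases "x = 0") auto

lemma M_form_eq_0_iff: "x \<bullet> (M *v x) = 0 \<longleftrightarrow> x = 0"
  using M_form_pos[of x] by (cases "x = 0") auto

lemma opt_cost_le:
  assumes "feasible A B E \<mu>W \<nu>"
  shows "opt_cost \<le> cost Q R \<nu>"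
proof -
  have "0 \<le> (\<integral>z. (snd z - (K *v fst z + F *v m)) \<bullet> (M *v (snd z - (K *v fst z + F *v m))) \<partial>\<nu>)"
    by (rule Bochner_Integration.integral_nonneg) (rule M_form_nonneg)
  then show ?thesis unfolding cost_feasible(2)[OF assms] by linarith
qed

text \<open>\<open>M\<close> is positive definite, so the excess cost, an integral of a nonnegative
  function, vanishes exactly when the deviation from the feedback is zero almost everywhere.\<close>

lemma optimal_iff_feedback:
  assumes "feasible A B E \<mu>W \<nu>"
  shows "cost Q R \<nu> = opt_cost \<longleftrightarrow> (AE z in \<nu>. snd z = K *v fst z + F *v m)"
proof -
  let ?d = "\<lambda>z. snd z - (K *v fst z + F *v m)"
  have "cost Q R \<nu> = opt_cost \<longleftrightarrow> (\<integral>z. ?d z \<bullet> (M *v ?d z) \<partial>\<nu>) = 0"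
    unfolding cost_feasible(2)[OF assms] by linarith
  also have "\<dots> \<longleftrightarrow> (AE z in \<nu>. ?d z \<bullet> (M *v ?d z) = 0)"
    by (rule integral_nonneg_eq_0_iff_AE[OF cost_feasible(1)[OF assms]]) (intro AE_I2 M_form_nonneg)
  also have "\<dots> \<longleftrightarrow> (AE z in \<nu>. snd z = K *v fst z + F *v m)"
    unfolding M_form_eq_0_iff right_minus_eq ..
  finally show ?thesis .
qed

end

subsection \<open>The optimal stationary law\<close>

text \<open>Each coordinate has law \<open>N\<close>, so the j-th term has expectation
  \<open>a j\<close> times that of \<open>h\<close>. Exchanging sum and integral shows that the
  series has finite expectation and therefore converges almost surely.\<close>

lemma iid_weighted_series:
  fixes a :: "nat \<Rightarrow> real" and h :: "'b \<Rightarrow> real"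
  assumes "prob_space N" and int: "integrable N h" and h: "\<And>x. 0 \<le> h x"
    and a: "summable a" "\<And>j. 0 \<le> a j"
  shows "AE \<omega> in PiM UNIV (\<lambda>_. N). summable (\<lambda>j. a j * h (\<omega> j))"
    and "integrable (PiM UNIV (\<lambda>_. N)) (\<lambda>\<omega>. \<Sum>j. a j * h (\<omega> j))"
proof -
  interpret N: prob_space N by fact
  let ?S = "PiM UNIV (\<lambda>_::nat. N)"
  have [measurable]: "h \<in> borel_measurable N" using int by simp
  have comp: "distr ?S N (\<lambda>\<omega>. \<omega> j) = N" for j
    by (rule distr_PiM_component) (simp_all add: N.prob_space_axioms)
  have intj: "integrable ?S (\<lambda>\<omega>. a j * h (\<omega> j))" for j
  proof -
    have "integrable (distr ?S N (\<lambda>\<omega>. \<omega> j)) h" unfolding comp by (rule int)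
    then have "integrable ?S (\<lambda>\<omega>. h (\<omega> j))" by (subst (asm) integrable_distr_eq) auto
    then show ?thesis by simp
  qed
  have valj: "(\<integral>\<omega>. a j * h (\<omega> j) \<partial>?S) = a j * (\<integral>x. h x \<partial>N)" for j
  proof -
    have "(\<integral>x. h x \<partial>distr ?S N (\<lambda>\<omega>. \<omega> j)) = (\<integral>\<omega>. h (\<omega> j) \<partial>?S)" by (rule integral_distr) auto
    then show ?thesis unfolding comp by simp
  qed
  have sum_val: "summable (\<lambda>j. a j * (\<integral>x. h x \<partial>N))" using a by (intro summable_mult2)
  have "(\<integral>\<^sup>+\<omega>. (\<Sum>j. ennreal (a j * h (\<omega> j))) \<partial>?S) = (\<Sum>j. \<integral>\<^sup>+\<omega>. ennreal (a j * h (\<omega> j)) \<partial>?S)"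
    by (rule nn_integral_suminf) measurable
  also have "\<dots> = (\<Sum>j. ennreal (a j * (\<integral>x. h x \<partial>N)))"
    unfolding valj[symmetric] by (subst nn_integral_eq_integral[OF intj]) (simp_all add: a h)
  also have "\<dots> = ennreal (\<Sum>j. a j * (\<integral>x. h x \<partial>N))"
    by (rule suminf_ennreal2[OF _ sum_val]) (simp add: a h)
  finally have "(\<integral>\<^sup>+\<omega>. (\<Sum>j. ennreal (a j * h (\<omega> j))) \<partial>?S) \<noteq> \<infinity>" by simp
  then have "AE \<omega> in ?S. (\<Sum>j. ennreal (a j * h (\<omega> j))) \<noteq> \<infinity>"
    by (intro nn_integral_noteq_infinite) auto
  then show *: "AE \<omega> in ?S. summable (\<lambda>j. a j * h (\<omega> j))"
    by eventually_elim (rule summable_suminf_not_top, auto simp: a h)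
  show "integrable ?S (\<lambda>\<omega>. \<Sum>j. a j * h (\<omega> j))"
  proof (rule integrable_suminf)
    show "AE \<omega> in ?S. summable (\<lambda>j. norm (a j * h (\<omega> j)))"
      using * by (simp add: a h)
    show "summable (\<lambda>j. \<integral>\<omega>. norm (a j * h (\<omega> j)) \<partial>?S)"
      using sum_val unfolding valj[symmetric] by (simp add: a h)
  qed (rule intj)
qed

text \<open>Cauchy-Schwarz with the weights \<open>a j\<close> bounds the squared sum by a weighted
  sum of squares, the quantity that a finite second moment of the noise controls.\<close>

lemma weighted_series_norm_bound:
  fixes v :: "nat \<Rightarrow> 'a::banach" and a y :: "nat \<Rightarrow> real"
  assumes a: "summable a" "\<And>j. 0 \<le> a j" and y: "\<And>j. 0 \<le> y j"
    and v: "\<And>j. norm (v j) \<le> a j * y j" and sum: "summable (\<lambda>j. a j * (y j)\<^sup>2)"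
  shows "summable v" and "(norm (suminf v))\<^sup>2 \<le> suminf a * (\<Sum>j. a j * (y j)\<^sup>2)"
proof -
  \<comment> \<open>The elementary bound of y by 1 + y^2 reduces absolute convergence to the two
    summability assumptions.\<close>
  have "norm (v j) \<le> a j + a j * (y j)\<^sup>2" for j
  proof -
    have "y j \<le> 1 + (y j)\<^sup>2"
      using y[of j] zero_le_power2[of "y j - 1"] by (simp add: power2_diff)
    from mult_left_mono[OF this a(2)[of j]] v[of j] show ?thesis by (simp add: distrib_left)
  qed
  then have sn: "summable (\<lambda>j. norm (v j))"
    by (intro summable_comparison_test'[OF summable_add[OF a(1) sum]]) auto
  then show "summable v" by (rule summable_norm_cancel)
  have "(\<Sum>j<n. norm (v j))\<^sup>2 \<le> suminf a * (\<Sum>j. a j * (y j)\<^sup>2)" for n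
  proof -
    \<comment> \<open>The weight is split evenly as \<open>sqrt (a j) * sqrt (a j)\<close> between
      the two Cauchy-Schwarz factors.\<close>
    have "(\<Sum>j<n. norm (v j))\<^sup>2 \<le> (\<Sum>j<n. sqrt (a j) * (sqrt (a j) * y j))\<^sup>2"
    proof (intro power_mono sum_mono sum_nonneg)
      fix j
      have "sqrt (a j) * (sqrt (a j) * y j) = a j * y j" using a(2)[of j] by (simp add: mult.assoc[symmetric])
      then show "norm (v j) \<le> sqrt (a j) * (sqrt (a j) * y j)" using v[of j] by (simp only:)
    qed simp
    also have "\<dots> \<le> (\<Sum>j<n. (sqrt (a j))\<^sup>2) * (\<Sum>j<n. (sqrt (a j) * y j)\<^sup>2)"
      by (rule Cauchy_Schwarz_ineq_sum)
    also have "\<dots> = (\<Sum>j<n. a j) * (\<Sum>j<n. a j * (y j)\<^sup>2)"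
      by (simp add: a power_mult_distrib)
    also have "\<dots> \<le> suminf a * (\<Sum>j. a j * (y j)\<^sup>2)"
      by (intro mult_mono sum_le_suminf a sum suminf_nonneg sum_nonneg mult_nonneg_nonneg) (auto simp: a)
    finally show ?thesis .
  qed
  then have "(\<Sum>j. norm (v j))\<^sup>2 \<le> suminf a * (\<Sum>j. a j * (y j)\<^sup>2)"
    by (intro LIMSEQ_le_const2[OF tendsto_power[OF summable_LIMSEQ[OF sn]]]) auto
  moreover have "(norm (suminf v))\<^sup>2 \<le> (\<Sum>j. norm (v j))\<^sup>2"
    by (intro power_mono summable_norm sn) simp
  ultimately show "(norm (suminf v))\<^sup>2 \<le> suminf a * (\<Sum>j. a j * (y j)\<^sup>2)" by linarith
qed

lemma pair_measure_distr_left: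
  assumes "prob_space N" and f: "f \<in> measurable M T"
  shows "distr M T f \<Otimes>\<^sub>M N = distr (M \<Otimes>\<^sub>M N) (T \<Otimes>\<^sub>M N) (\<lambda>(x, y). (f x, y))"
proof -
  interpret N: prob_space N by fact
  show ?thesis
    using pair_measure_distr[OF f measurable_ident_sets[of N N, OF refl]] N.sigma_finite_measure_axioms
    by (simp add: distr_id2)
qed

lemma AE_pair_fst:
  assumes "prob_space N" "AE x in M. P x"
  shows "AE z in M \<Otimes>\<^sub>M N. P (fst z)"
proof (rule AE_distrD[OF measurable_fst])
  show "AE x in distr (M \<Otimes>\<^sub>M N) M fst. P x"
    unfolding prob_space.distr_pair_fst[OF assms(1)] by (rule assms(2))
qed

lemma borel_measurable_fst [measurable]:
  "fst \<in> borel_measurable (borel :: ('a::topological_space \<times> 'b::topological_space) measure)"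
  by (intro borel_measurable_continuous_onI continuous_intros)

lemma borel_measurable_snd [measurable]:
  "snd \<in> borel_measurable (borel :: ('a::topological_space \<times> 'b::topological_space) measure)"
  by (intro borel_measurable_continuous_onI continuous_intros)

section \<open>The stationary state and the optimal joint law\<close>

context lq_stationary
begin

abbreviation "X \<equiv> Xinf A B R P E G \<mu>W"
abbreviation "S \<equiv> iid_space \<mu>W"
abbreviation "noise_term j w \<equiv> matpow Ac j *v (E *v (w - m))"

lemma prob_space_S: "prob_space S"
  unfolding iid_space_def by (intro prob_space_PiM W.prob_space_axioms)

lemma Xinf_measurable [measurable]: "X \<in> borel_measurable S"
  unfolding Xinf_def iid_space_def by measurable

text \<open>The j-th term is at most \<open>a j\<close> times the norm of
  \<open>E *v (\<omega> j - m)\<close>, whose square is integrable, so the two preceding series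
  lemmas apply with that square as \<open>h\<close>.\<close>

lemma Xinf_series:
  shows "AE \<omega> in S. summable (\<lambda>j. noise_term j (\<omega> j))"
    and "square_integrable S X"
proof -
  interpret S: prob_space S by (rule prob_space_S)
  obtain a where a: "summable a" "\<And>k. 0 \<le> a k" "\<And>k x. norm (matpow Ac k *v x) \<le> a k * norm x"
    using schur_stable_bound[OF P_stab] by blast
  let ?y = "\<lambda>w. norm (E *v (w - m))" and ?Z = "\<lambda>\<omega>. \<Sum>j. noise_term j (\<omega> j)"
  have "square_integrable \<mu>W (\<lambda>w. E *v (w - m))"
    by (intro square_integrable_intros W_square_integrable W.square_integrable_const)
  then have int: "integrable \<mu>W (\<lambda>w. (?y w)\<^sup>2)" by (simp add: square_integrable_def)
  note series = iid_weighted_series[OF W.prob_space_axioms int zero_le_power2 a(1,2), folded iid_space_def]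
  show "AE \<omega> in S. summable (\<lambda>j. noise_term j (\<omega> j))"
    using series(1) by eventually_elim (rule weighted_series_norm_bound(1)[OF a(1,2) norm_ge_zero a(3)])
  have Z [measurable]: "?Z \<in> borel_measurable S"
    unfolding iid_space_def by measurable
  have "AE \<omega> in S. norm ((norm (?Z \<omega>))\<^sup>2) \<le> norm (suminf a * (\<Sum>j. a j * (?y (\<omega> j))\<^sup>2))"
    using series(1)
  proof eventually_elim
    case (elim \<omega>)
    from weighted_series_norm_bound(2)[OF a(1,2) norm_ge_zero a(3) elim]
    show ?case by simp
  qed
  then have "integrable S (\<lambda>\<omega>. (norm (?Z \<omega>))\<^sup>2)"
    by (rule Bochner_Integration.integrable_bound[rotated 2]) (use series(2) in auto)
  then have "square_integrable S ?Z" by (simp add: square_integrable_def Z)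
  then show "square_integrable S X"
    unfolding Xinf_def by (intro square_integrable_add S.square_integrable_const)
qed

text \<open>Prepending \<open>w\<close> shifts the old noise by one index, which applies
  \<open>Ac\<close> once to the old series, and adds the new term \<open>E *v (w - m)\<close>. The
  deterministic part is a fixed point of the mean dynamics, which cancels
  \<open>E *v m\<close>.\<close>

lemma Xinf_case_nat:
  assumes "summable (\<lambda>j. noise_term j (\<omega> j))"
  shows "X (case_nat w \<omega>) = Ac *v X \<omega> + B *v (F *v m) + E *v w"
proof -
  define x0 where "x0 = matrix_inv (mat 1 - Ac) *v (Ftil B R P E G *v m)"
  have "(mat 1 - Ac) *v x0 = Ftil B R P E G *v m"
    unfolding x0_def by (rule mult_matrix_inv[OF schur_stable_invertible[OF P_stab]])
  then have x0: "x0 = Ac *v x0 + B *v (F *v m) + E *v m"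
    by (simp add: Ftil_def matrix_vector_mult_diff_rdistrib matrix_vector_mult_add_rdistrib
      matrix_vector_mul_assoc algebra_simps)
  interpret L: bounded_linear "(*v) Ac" by (rule matrix_vector_mul_bounded_linear)
  let ?f = "\<lambda>j. noise_term j (case j of 0 \<Rightarrow> w | Suc i \<Rightarrow> \<omega> i)"
  have suc: "?f (Suc j) = Ac *v noise_term j (\<omega> j)" for j
    by (simp add: matrix_vector_mul_assoc[symmetric])
  \<comment> \<open>Convergence is assumed for the old noise only; the new series has one extra head
    term, and its tail is the image of the old series under \<open>Ac\<close>.\<close>
  have sf: "summable ?f"
    by (subst summable_Suc_iff[symmetric], subst suc) (rule L.summable[OF assms])
  have "suminf ?f = (\<Sum>j. Ac *v noise_term j (\<omega> j)) + E *v (w - m)"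
    using suminf_split_head[OF sf] unfolding suc by simp
  also have "(\<Sum>j. Ac *v noise_term j (\<omega> j)) = Ac *v (\<Sum>j. noise_term j (\<omega> j))"
    by (rule L.suminf[OF assms, symmetric])
  finally have "X (case_nat w \<omega>) = x0 + Ac *v (\<Sum>j. noise_term j (\<omega> j)) + E *v (w - m)"
    by (simp add: Xinf_def x0_def)
  moreover have "X \<omega> = x0 + (\<Sum>j. noise_term j (\<omega> j))"
    by (simp add: Xinf_def x0_def)
  moreover have "x0 - E *v m = Ac *v x0 + B *v (F *v m)"
    unfolding diff_eq_eq by (rule x0)
  ultimately show ?thesis
    by (simp add: matrix_vector_right_distrib matrix_vector_mult_diff_distrib)
qed

lemma distr_Xinf_next:
  "distr (S \<Otimes>\<^sub>M \<mu>W) borel (\<lambda>(\<omega>, w). Ac *v X \<omega> + B *v (F *v m) + E *v w) = distr S borel X"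
proof -
  interpret S: prob_space S by (rule prob_space_S)
  interpret seq: sequence_space \<mu>W by unfold_locales
  interpret pair: pair_prob_space \<mu>W S ..
  let ?c = "\<lambda>(w, \<omega>). case_nat w \<omega>"
  have c [measurable]: "?c \<in> measurable (\<mu>W \<Otimes>\<^sub>M S) S"
    unfolding iid_space_def by measurable
  have iter: "distr (\<mu>W \<Otimes>\<^sub>M S) S ?c = S" using seq.PiM_iter unfolding iid_space_def .
  have "AE z in S \<Otimes>\<^sub>M \<mu>W. summable (\<lambda>j. noise_term j (fst z j))"
    by (rule AE_pair_fst[OF W.prob_space_axioms Xinf_series(1)])
  \<comment> \<open>The shift identity needs convergence of the series and so holds only almost
    everywhere.\<close>
  then have ae: "AE z in S \<Otimes>\<^sub>M \<mu>W. (case z of (\<omega>, w) \<Rightarrow> Ac *v X \<omega> + B *v (F *v m) + E *v w)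
      = (X \<circ> ?c \<circ> (\<lambda>(\<omega>, w). (w, \<omega>))) z"
    by eventually_elim (simp add: split_beta' Xinf_case_nat)
  have "distr (S \<Otimes>\<^sub>M \<mu>W) borel (\<lambda>(\<omega>, w). Ac *v X \<omega> + B *v (F *v m) + E *v w)
      = distr (S \<Otimes>\<^sub>M \<mu>W) borel (X \<circ> ?c \<circ> (\<lambda>(\<omega>, w). (w, \<omega>)))"
    by (rule distr_cong_AE[OF refl refl ae]) measurable
  \<comment> \<open>The constraint has the fresh noise as second factor, whereas prepending takes it
    first; swapping the factors preserves the product measure.\<close>
  also have "\<dots> = distr (distr (S \<Otimes>\<^sub>M \<mu>W) (\<mu>W \<Otimes>\<^sub>M S) (\<lambda>(\<omega>, w). (w, \<omega>))) borel (X \<circ> ?c)"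
    by (rule distr_distr[symmetric]) measurable
  also have "\<dots> = distr (\<mu>W \<Otimes>\<^sub>M S) borel (X \<circ> ?c)"
    by (subst pair.distr_pair_swap[symmetric]) (rule refl)
  also have "\<dots> = distr (distr (\<mu>W \<Otimes>\<^sub>M S) S ?c) borel X"
    by (rule distr_distr[symmetric]) measurable
  finally show ?thesis unfolding iter .
qed

abbreviation "opt_law \<equiv> distr S borel (\<lambda>\<omega>. (X \<omega>, K *v X \<omega> + F *v m))"

lemma opt_law_marginals:
  "distr opt_law borel fst = muX_diamond A B R P E G \<mu>W"
  "distr opt_law borel snd = muU_diamond A B R P E G \<mu>W"
  by (subst distr_distr; simp add: borel_prod[symmetric] muX_diamond_def muU_diamond_def comp_def)+

text \<open>Under the feedback the next state is \<open>Ac *v x + B *v (F *v m) + E *v w\<close>, so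
  the constraint reduces to the stationarity of the law of \<open>X\<close>.\<close>

lemma opt_law_feasible: "feasible A B E \<mu>W opt_law"
proof -
  interpret S: prob_space S by (rule prob_space_S)
  let ?f = "\<lambda>\<omega>. (X \<omega>, K *v X \<omega> + F *v m)"
  let ?g = "\<lambda>(z, w). A *v fst z + B *v snd z + E *v w"
  have f [measurable]: "?f \<in> measurable S borel" unfolding borel_prod[symmetric] by measurable
  have sq: "square_integrable S (\<lambda>\<omega>. K *v X \<omega> + F *v m)"
    by (intro square_integrable_intros Xinf_series S.square_integrable_const)
  have "distr (opt_law \<Otimes>\<^sub>M \<mu>W) borel ?g
      = distr (S \<Otimes>\<^sub>M \<mu>W) borel (?g \<circ> (\<lambda>(\<omega>, w). (?f \<omega>, w)))"
    unfolding pair_measure_distr_left[OF W.prob_space_axioms f] by (rule distr_distr) measurable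
  also have "?g \<circ> (\<lambda>(\<omega>, w). (?f \<omega>, w)) = (\<lambda>(\<omega>, w). Ac *v X \<omega> + B *v (F *v m) + E *v w)"
    by (auto simp: fun_eq_iff Acl_mult matrix_vector_right_distrib)
  also have "distr (S \<Otimes>\<^sub>M \<mu>W) borel \<dots> = distr S borel X" by (rule distr_Xinf_next)
  also have "\<dots> = distr opt_law borel fst" by (simp add: opt_law_marginals muX_diamond_def)
  finally have "distr (opt_law \<Otimes>\<^sub>M \<mu>W) borel ?g = distr opt_law borel fst" .
  then show ?thesis
    using Xinf_series(2) sq S.prob_space_distr[OF f]
    unfolding feasible_def square_integrable_def by (simp add: integrable_distr_eq)
qed

lemma opt_law_optimal: "cost Q R opt_law = opt_cost"
proof -
  have f: "(\<lambda>\<omega>. (X \<omega>, K *v X \<omega> + F *v m)) \<in> measurable S (borel \<Otimes>\<^sub>M borel)" by measurable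
  show ?thesis
    unfolding optimal_iff_feedback[OF opt_law_feasible]
    by (subst AE_distr_iff) (use f in \<open>auto simp: borel_prod[symmetric]\<close>)
qed

text \<open>The input of an optimal law equals the feedback almost everywhere. Substituting it turns
  the constraint into closed-loop stationarity of the state law and makes the input law its
  image.\<close>

lemma optimal_law_stationary:
  assumes feas: "feasible A B E \<mu>W \<nu>" and opt: "cost Q R \<nu> = opt_cost"
  defines "\<mu> \<equiv> distr \<nu> borel fst"
  shows "prob_space \<mu>" "integrable \<mu> norm"
    "distr (\<mu> \<Otimes>\<^sub>M \<mu>W) borel (\<lambda>(x, w). Ac *v x + B *v (F *v m) + E *v w) = \<mu>"
    "distr \<nu> borel snd = distr \<mu> borel (\<lambda>x. K *v x + F *v m)"
proof -
  have nu: "prob_space \<nu>" "sets \<nu> = sets borel"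
    and L2: "integrable \<nu> (\<lambda>z. (norm (fst z))\<^sup>2)"
    and st: "distr (\<nu> \<Otimes>\<^sub>M \<mu>W) borel (\<lambda>(z, w). A *v fst z + B *v snd z + E *v w) = distr \<nu> borel fst"
    using feas by (simp_all only: feasible_def)
  interpret nu: prob_space \<nu> by fact
  have [measurable_cong]: "sets \<nu> = sets (borel \<Otimes>\<^sub>M borel)" unfolding nu(2) borel_prod ..
  have fst: "fst \<in> measurable \<nu> borel" by measurable
  show "prob_space \<mu>" unfolding \<mu>_def by (rule nu.prob_space_distr[OF fst])
  have "square_integrable \<nu> fst" using L2 by (simp add: square_integrable_def)
  then show "integrable \<mu> norm"
    unfolding \<mu>_def by (subst integrable_distr_eq) (simp_all add: nu.square_integrable_imp_norm_integrable)
  have fb: "AE z in \<nu>. snd z = K *v fst z + F *v m"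
    using opt optimal_iff_feedback[OF feas] by blast
  have "distr (\<mu> \<Otimes>\<^sub>M \<mu>W) borel (\<lambda>(x, w). Ac *v x + B *v (F *v m) + E *v w)
      = distr (\<nu> \<Otimes>\<^sub>M \<mu>W) borel ((\<lambda>(x, w). Ac *v x + B *v (F *v m) + E *v w) \<circ> (\<lambda>(z, w). (fst z, w)))"
    unfolding \<mu>_def pair_measure_distr_left[OF W.prob_space_axioms fst] by (rule distr_distr) measurable
  also have "\<dots> = distr (\<nu> \<Otimes>\<^sub>M \<mu>W) borel (\<lambda>(z, w). A *v fst z + B *v snd z + E *v w)"
  proof (rule distr_cong_AE[OF refl refl])
    show "AE z in \<nu> \<Otimes>\<^sub>M \<mu>W. ((\<lambda>(x, w). Ac *v x + B *v (F *v m) + E *v w) \<circ> (\<lambda>(z, w). (fst z, w))) z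
        = (case z of (z, w) \<Rightarrow> A *v fst z + B *v snd z + E *v w)"
      using AE_pair_fst[OF W.prob_space_axioms fb]
      by eventually_elim (simp add: split_beta' Acl_mult matrix_vector_right_distrib)
  qed measurable
  also have "\<dots> = \<mu>" unfolding st \<mu>_def ..
  finally show "distr (\<mu> \<Otimes>\<^sub>M \<mu>W) borel (\<lambda>(x, w). Ac *v x + B *v (F *v m) + E *v w) = \<mu>" .
  have "distr \<nu> borel snd = distr \<nu> borel ((\<lambda>x. K *v x + F *v m) \<circ> fst)"
    by (rule distr_cong_AE[OF refl refl]) (use fb in \<open>simp_all add: comp_def\<close>)
  also have "\<dots> = distr \<mu> borel (\<lambda>x. K *v x + F *v m)"
    unfolding \<mu>_def by (rule distr_distr[symmetric]) measurable
  finally show "distr \<nu> borel snd = distr \<mu> borel (\<lambda>x. K *v x + F *v m)" .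
qed

text \<open>Both \<nu> and \<open>opt_law\<close> are optimal, so their state marginals are
  stationary for the same closed loop and coincide; the input marginals are images of these under
  the same map.\<close>

lemma optimal_law_unique:
  assumes nu: "feasible A B E \<mu>W \<nu>" "cost Q R \<nu> = opt_cost"
  shows "distr \<nu> borel fst = muX_diamond A B R P E G \<mu>W"
    and "distr \<nu> borel snd = muU_diamond A B R P E G \<mu>W"
proof -
  note st = optimal_law_stationary[OF nu]
    and st0 = optimal_law_stationary[OF opt_law_feasible opt_law_optimal]
  have eq: "distr \<nu> borel fst = distr opt_law borel fst"
    by (rule stationary_law_unique[OF P_stab W.prob_space_axioms W_sets
      st(1) sets_distr st(2,3) st0(1) sets_distr st0(2,3)])
  then show "distr \<nu> borel fst = muX_diamond A B R P E G \<mu>W"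
    unfolding opt_law_marginals .
  show "distr \<nu> borel snd = muU_diamond A B R P E G \<mu>W"
    unfolding opt_law_marginals(2)[symmetric] st(4) st0(4) eq ..
qed

end

theorem theorem2:
  fixes A :: "real^'nx^'nx" and B :: "real^'nu^'nx" and E :: "real^'nw^'nx"
    and Q :: "real^'nx^'nx" and R :: "real^'nu^'nu"
    and P :: "real^'nx^'nx" and G :: "real^'nw^'nx"
    and \<mu>W :: "(real^'nw) measure"
  assumes Q: "psd Q" and R: "pd R"
    and stab: "stabilizable A B" and det: "detectable_sqrt A Q"
    and P_psd: "psd P" and P_dare: "dare A B Q R P"
    and P_stab: "schur_stable (Acl A B R P)"
    and G_eq: "G = transpose (Acl A B R P) ** (P ** E + G)"
    and W_prob: "prob_space \<mu>W" and W_sets: "sets \<mu>W = sets borel"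
    and W_L2: "integrable \<mu>W (\<lambda>w. (norm w)\<^sup>2)"
  shows "(\<exists>\<nu>. feasible A B E \<mu>W \<nu> \<and>
            cost Q R \<nu> = wnorm2 \<mu>W (transpose E ** P ** E)
                          + mean \<mu>W \<bullet> (DeltaS B R P E G *v mean \<mu>W))
       \<and> (\<forall>\<nu>. feasible A B E \<mu>W \<nu> \<longrightarrow>
            wnorm2 \<mu>W (transpose E ** P ** E) + mean \<mu>W \<bullet> (DeltaS B R P E G *v mean \<mu>W)
              \<le> cost Q R \<nu>)
       \<and> (\<forall>\<nu>. feasible A B E \<mu>W \<nu> \<and>
            cost Q R \<nu> = wnorm2 \<mu>W (transpose E ** P ** E)
                          + mean \<mu>W \<bullet> (DeltaS B R P E G *v mean \<mu>W)
            \<longrightarrow> distr \<nu> borel fst = muX_diamond A B R P E G \<mu>W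
              \<and> distr \<nu> borel snd = muU_diamond A B R P E G \<mu>W)"
proof -
  interpret W: prob_space \<mu>W by (rule W_prob)
  interpret lq_stationary A B E Q R P G \<mu>W
    by unfold_locales (fact R P_psd P_dare P_stab G_eq W_sets W_L2)+
  show ?thesis
    unfolding opt_cost_def[symmetric]
    using opt_law_feasible opt_law_optimal opt_cost_le optimal_law_unique by blast
qed

end
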